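(* Let $G$ and $H$ be finite simple undirected graphs, where $G$ has $s_1$ vertices and $t_1$ edges and $H$ has $s_2$ vertices and $t_2$ edges. Then $$Mo(G\circ H)\le s_1\,irr(H)+(s_2+1)\,Mo(G)+s_1s_2\,\left|2-s_1-s_1s_2\right|+2s_1t_2 .$$
   Context: For a graph $X$ and an edge $e=uv$ of $X$, $n_u(e\mid X)$ denotes the number of vertices $w$ of $X$ with $d_X(w,u)<d_X(w,v)$ ($d_X$ the shortest-path distance). The Mostar index is $Mo(X)=\sum_{uv\in E(X)}|n_u(e\mid X)-n_v(e\mid X)|$. The irregularity is $irr(X)=\sum_{uv\in E(X)}|\deg_X(u)-\deg_X(v)|$. The corona product $G\circ H$ is obtained from one copy of $G$ and $s_1$ disjoint copies of $H$ by joining the $g$-th vertex of $G$ to every vertex of the $g$-th copy of $H$, $1\le g\le s_1$. *)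

theory Defs
  imports Main "HOL-Library.Extended_Nat"
begin

datatype 'a ugraph = UGraph (verts: "'a set") (edges: "'a set set")

definition finite_simple_graph :: "'a ugraph \<Rightarrow> bool" where
  "finite_simple_graph X \<longleftrightarrow>
     finite (verts X) \<and> (\<forall>e \<in> edges X. e \<subseteq> verts X \<and> card e = 2)"

definition path_between :: "'a ugraph \<Rightarrow> 'a \<Rightarrow> 'a list \<Rightarrow> 'a \<Rightarrow> bool" where
  "path_between X u p v \<longleftrightarrow>
     p \<noteq> [] \<and> hd p = u \<and> last p = v \<and> distinct p \<and> set p \<subseteq> verts X \<and>
     (\<forall>i. Suc i < length p \<longrightarrow> {p ! i, p ! Suc i} \<in> edges X)"

text \<open>A path is given by its list of vertices, so its length is one less than the length of
  the list. The distance is \<open>\<infinity>\<close> when no path exists, as the infimum of the empty set.\<close>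

definition graph_dist :: "'a ugraph \<Rightarrow> 'a \<Rightarrow> 'a \<Rightarrow> enat" where
  "graph_dist X u v = Inf {enat (length p - 1) | p. path_between X u p v}"

definition degree :: "'a ugraph \<Rightarrow> 'a \<Rightarrow> nat" where
  "degree X u = card {e \<in> edges X. u \<in> e}"

text \<open>For an edge \<open>e = {u, v}\<close>, this is \<open>n\<^sub>u(e | X)\<close>.\<close>

definition closer_count :: "'a ugraph \<Rightarrow> 'a \<Rightarrow> 'a \<Rightarrow> nat" where
  "closer_count X u v = card {w \<in> verts X. graph_dist X w u < graph_dist X w v}"

text \<open>Sum over unordered edges of a symmetric function of the two endpoints; each edge is
  counted once. Symmetry makes the definite description well defined.\<close>

definition edge_sum :: "'a ugraph \<Rightarrow> ('a \<Rightarrow> 'a \<Rightarrow> int) \<Rightarrow> int" where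
  "edge_sum X f = (\<Sum>e \<in> edges X. THE r. \<exists>u v. e = {u, v} \<and> r = f u v)"

lemma edge_sum_summand:
  assumes "\<And>x y. f x y = f y x"
  shows "(THE r. \<exists>x y. {u, v} = {x, y} \<and> r = f x y) = f u v"
  using assms by (auto simp: doubleton_eq_iff intro!: the_equality)

definition Mostar :: "'a ugraph \<Rightarrow> int" where
  "Mostar X = edge_sum X (\<lambda>u v. \<bar>int (closer_count X u v) - int (closer_count X v u)\<bar>)"

definition irr :: "'a ugraph \<Rightarrow> int" where
  "irr X = edge_sum X (\<lambda>u v. \<bar>int (degree X u) - int (degree X v)\<bar>)"

text \<open>\<open>Inl g\<close> is the vertex \<open>g\<close> of \<open>G\<close>, and \<open>Inr (g, h)\<close> is the vertex \<open>h\<close> in the copy of \<open>H\<close>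
  attached to \<open>g\<close>.\<close>

definition corona :: "'a ugraph \<Rightarrow> 'b ugraph \<Rightarrow> ('a + 'a \<times> 'b) ugraph" where
  "corona G H = UGraph
     (Inl ` verts G \<union> Inr ` (verts G \<times> verts H))
     ({Inl ` e | e. e \<in> edges G}
      \<union> {(\<lambda>h. Inr (g, h)) ` e | g e. g \<in> verts G \<and> e \<in> edges H}
      \<union> {{Inl g, Inr (g, h)} | g h. g \<in> verts G \<and> h \<in> verts H})"

end

theory Submission
  imports Defs
begin

text \<open>
  Distances in the corona are determined by distances in \<open>G\<close>: a copy of \<open>H\<close> can only be left
  through its attaching vertex, and inside a copy all distances are at most 2. Hence the three
  kinds of edges contribute as follows. An edge \<open>uv\<close> of \<open>G\<close> has \<open>s\<^sub>2 + 1\<close> times the imbalance it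
  has in \<open>G\<close>. For an edge \<open>hk\<close> in a copy of \<open>H\<close> only the neighbours of \<open>h\<close> and \<open>k\<close> in that
  copy matter, and the common ones cancel, so its imbalance is \<open>|deg h - deg k|\<close>. For a joining edge
  between \<open>g\<close> and \<open>h\<close>, just the vertex \<open>h\<close> is closer to \<open>h\<close>, and all
  of the component of \<open>g\<close> except \<open>h\<close> and its neighbours in the copy is closer to \<open>g\<close>; with \<open>c\<close> the
  order of the component of \<open>g\<close> in \<open>G\<close> the imbalance is \<open>|c (s\<^sub>2 + 1) - 2 - deg h|\<close>, and the handshake
  lemma sums the degrees to \<open>2 t\<^sub>2\<close>.
\<close>

section \<open>Distances\<close>

lemma path_between_Cons:
  assumes "path_between X y p u" and "{x, y} \<in> edges X" and "x \<in> verts X" and "x \<notin> set p"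
  shows "path_between X x (x # p) u"
proof -
  have "{(x # p) ! i, (x # p) ! Suc i} \<in> edges X" if "Suc i < length (x # p)" for i
    using that assms by (cases i) (auto simp: path_between_def hd_conv_nth)
  then show ?thesis using assms by (auto simp: path_between_def)
qed

lemma path_between_drop:
  assumes "path_between X y p u" and "i < length p"
  shows "path_between X (p ! i) (drop i p) u"
  using assms by (auto simp: path_between_def hd_drop_conv_nth dest: in_set_dropD)

lemma graph_dist_le: "path_between X u p v \<Longrightarrow> graph_dist X u v \<le> enat (length p - 1)"
  unfolding graph_dist_def by (rule Inf_lower) blast

text \<open>A finite value rules out the infimum of the empty set, which is infinite, and the
  infimum of a nonempty set in \<open>enat\<close> is attained. \<open>length p\<close> counts
  vertices, hence the \<open>Suc\<close>.\<close>

lemma graph_dist_path: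
  assumes "graph_dist X u v = enat n"
  obtains p where "path_between X u p v" and "length p = Suc n"
proof -
  let ?S = "{enat (length p - 1) | p. path_between X u p v}"
  have "?S \<noteq> {}" using assms unfolding graph_dist_def by (auto simp: Inf_enat_def split: if_splits)
  then have "Inf ?S \<in> ?S" unfolding Inf_enat_def by (auto intro: LeastI)
  then obtain p where p: "path_between X u p v" "n = length p - 1"
    using assms unfolding graph_dist_def by auto
  then have "p \<noteq> []" by (simp add: path_between_def)
  with p show ?thesis by (intro that[of p]) (cases p, auto)
qed

lemma graph_dist_self: "u \<in> verts X \<Longrightarrow> graph_dist X u u = 0"
  using graph_dist_le[of X u "[u]" u] by (simp add: path_between_def zero_enat_def[symmetric])

lemma graph_dist_eq_0:
  assumes "graph_dist X u v = 0"
  shows "u = v"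
proof -
  obtain p where "path_between X u p v" "length p = Suc 0"
    using assms graph_dist_path[of X u v 0] by (auto simp: zero_enat_def)
  then show ?thesis by (auto simp: path_between_def length_Suc_conv)
qed

text \<open>Paths have distinct vertices, so \<open>x\<close> can be put in front of a shortest path
  from \<open>y\<close> only if it does not occur there. If it does, the tail of that path from
  \<open>x\<close> onwards is already short enough.\<close>

lemma graph_dist_edge:
  assumes "finite_simple_graph X" and "{x, y} \<in> edges X"
  shows "graph_dist X x u \<le> graph_dist X y u + 1"
proof (cases "graph_dist X y u")
  case (enat n)
  then obtain p where p: "path_between X y p u" "length p = Suc n" by (rule graph_dist_path)
  have x: "x \<in> verts X" using assms by (auto simp: finite_simple_graph_def)
  show ?thesis
  proof (cases "x \<in> set p")
    case True
    then obtain i where i: "i < length p" "p ! i = x" by (auto simp: in_set_conv_nth)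
    from graph_dist_le[OF path_between_drop[OF p(1) i(1)]] i p(2) enat
    show ?thesis by (auto simp: one_enat_def elim!: order_trans)
  next
    case False
    from graph_dist_le[OF path_between_Cons[OF p(1) assms(2) x False]] p(2) enat
    show ?thesis by (simp add: one_enat_def)
  qed
qed simp

text \<open>The second vertex of a shortest path works: the rest of the path bounds its distance
  from above, \<open>graph_dist_edge\<close> from below.\<close>

lemma graph_dist_Suc_neighbour:
  assumes "finite_simple_graph X" and "graph_dist X x u = enat (Suc n)"
  obtains y where "{x, y} \<in> edges X" and "graph_dist X y u = enat n"
proof -
  obtain p where p: "path_between X x p u" "length p = Suc (Suc n)"
    using assms(2) by (rule graph_dist_path)
  then have e: "{x, p ! 1} \<in> edges X" by (auto simp: path_between_def hd_conv_nth)
  have le: "graph_dist X (p ! 1) u \<le> enat n"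
    using graph_dist_le[OF path_between_drop[OF p(1), of 1]] p(2) by simp
  have "graph_dist X x u \<le> graph_dist X (p ! 1) u + 1" by (rule graph_dist_edge[OF assms(1) e])
  with le assms(2) have "graph_dist X (p ! 1) u = enat n"
    by (cases "graph_dist X (p ! 1) u") (auto simp: one_enat_def)
  with e show ?thesis by (rule that)
qed

section \<open>Certifying distances by a potential function\<close>

lemma lipschitz_le_path_length:
  fixes f :: "'a \<Rightarrow> enat"
  assumes "\<And>x y. {x, y} \<in> edges X \<Longrightarrow> f x \<le> f y + 1" and "f u = 0"
  shows "path_between X v p u \<Longrightarrow> f v \<le> enat (length p - 1)"
proof (induction p arbitrary: v)
  case (Cons x q)
  show ?case
  proof (cases q)
    case Nil
    with Cons.prems assms(2) show ?thesis by (auto simp: path_between_def)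
  next
    case (Cons y r)
    have "path_between X y q u" using path_between_drop[OF Cons.prems, of 1] Cons by simp
    from Cons.IH[OF this] have "f y \<le> enat (length q - 1)" .
    moreover have "f v \<le> f y + 1"
      using Cons.prems Cons by (intro assms(1)) (fastforce simp: path_between_def)
    ultimately have "f v \<le> enat (length q - 1) + 1" by (meson add_right_mono order_trans)
    then show ?thesis using Cons by (simp add: one_enat_def)
  qed
qed (simp add: path_between_def)

text \<open>Recognises a guessed function \<open>f\<close> as the distance to \<open>u\<close> by
  local checks on edges. Since \<open>f\<close> changes by at most 1 along an edge, it is a lower
  bound for path lengths; since each positive finite value has a neighbour with the value one
  smaller, descending yields a path of length \<open>f v\<close>. Where \<open>f v\<close> is
  infinite the upper bound is trivial.\<close>

lemma graph_dist_eqI: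
  fixes f :: "'a \<Rightarrow> enat"
  assumes X: "finite_simple_graph X"
    and u: "u \<in> verts X" "f u = 0"
    and lip: "\<And>x y. {x, y} \<in> edges X \<Longrightarrow> f x \<le> f y + 1"
    and zero: "\<And>x. x \<in> verts X \<Longrightarrow> f x = 0 \<Longrightarrow> x = u"
    and desc: "\<And>x n. x \<in> verts X \<Longrightarrow> f x = enat (Suc n) \<Longrightarrow>
      \<exists>y. {x, y} \<in> edges X \<and> f y = enat n"
    and v: "v \<in> verts X"
  shows "graph_dist X v u = f v"
proof (rule antisym)
  show "f v \<le> graph_dist X v u"
    unfolding graph_dist_def using lipschitz_le_path_length[where f = f and X = X, OF lip u(2)]
    by (auto intro!: Inf_greatest)
  \<comment> \<open>The bound on \<open>f\<close> along \<open>p\<close> strengthens the induction: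
    a new vertex of value \<open>Suc n\<close> cannot lie on a path with values at most
    \<open>n\<close>, so the extended list stays distinct.\<close>
  have path: "\<exists>p. path_between X w p u \<and> length p = Suc n \<and> (\<forall>x \<in> set p. f x \<le> enat n)"
    if "w \<in> verts X" "f w = enat n" for w n
    using that
  proof (induction n arbitrary: w)
    case 0
    then have "w = u" by (intro zero) (auto simp: zero_enat_def)
    with u show ?case by (intro exI[of _ "[u]"]) (auto simp: path_between_def)
  next
    case (Suc n)
    then obtain y where y: "{w, y} \<in> edges X" "f y = enat n" using desc by blast
    then have "y \<in> verts X" using X by (auto simp: finite_simple_graph_def)
    with Suc.IH y obtain p where p: "path_between X y p u" "length p = Suc n"
      "\<forall>x \<in> set p. f x \<le> enat n" by blast
    have "w \<notin> set p" using p(3) Suc.prems by auto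
    from path_between_Cons[OF p(1) y(1) Suc.prems(1) this]
    have "path_between X w (w # p) u" .
    moreover have "\<forall>x \<in> set (w # p). f x \<le> enat (Suc n)"
      using p(3) Suc.prems by (auto elim!: order_trans)
    ultimately show ?case using p(2) by (intro exI[of _ "w # p"]) auto
  qed
  show "graph_dist X v u \<le> f v"
  proof (cases "f v")
    case (enat n)
    from path[OF v enat] graph_dist_le enat show ?thesis by fastforce
  qed simp
qed

section \<open>Edges and degrees\<close>

lemma edge_cases:
  assumes "finite_simple_graph X" and "e \<in> edges X"
  obtains u v where "e = {u, v}" and "u \<noteq> v" and "u \<in> verts X" and "v \<in> verts X"
proof -
  have "card e = 2" "e \<subseteq> verts X" using assms by (auto simp: finite_simple_graph_def)
  then show ?thesis using that by (auto simp: card_2_iff)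
qed

lemma finite_edges: "finite_simple_graph X \<Longrightarrow> finite (edges X)"
  by (rule finite_subset[of _ "Pow (verts X)"]) (auto simp: finite_simple_graph_def)

lemma edge_irrefl: "finite_simple_graph X \<Longrightarrow> {x, x} \<notin> edges X"
  by (auto simp: finite_simple_graph_def)

lemma edge_in_verts:
  "finite_simple_graph X \<Longrightarrow> {x, y} \<in> edges X \<Longrightarrow> x \<in> verts X \<and> y \<in> verts X"
  by (auto simp: finite_simple_graph_def)

definition nbrs :: "'a ugraph \<Rightarrow> 'a \<Rightarrow> 'a set" where
  "nbrs X u = {v. {u, v} \<in> edges X}"

lemma nbrs_subset: "finite_simple_graph X \<Longrightarrow> nbrs X u \<subseteq> verts X"
  by (auto simp: nbrs_def finite_simple_graph_def)

lemma finite_nbrs: "finite_simple_graph X \<Longrightarrow> finite (nbrs X u)"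
  by (rule finite_subset[OF nbrs_subset]) (auto simp: finite_simple_graph_def)

lemma degree_eq_card_nbrs:
  assumes "finite_simple_graph X"
  shows "degree X u = card (nbrs X u)"
proof -
  have "{e \<in> edges X. u \<in> e} = (\<lambda>v. {u, v}) ` nbrs X u"
  proof (intro equalityI subsetI)
    fix e assume e: "e \<in> {e \<in> edges X. u \<in> e}"
    then obtain x y where "e = {x, y}" using edge_cases[OF assms, of e] by blast
    with e show "e \<in> (\<lambda>v. {u, v}) ` nbrs X u"
      by (cases "u = x") (auto simp: nbrs_def insert_commute)
  qed (auto simp: nbrs_def)
  moreover have "inj_on (\<lambda>v. {u, v}) (nbrs X u)"
    by (auto simp: inj_on_def doubleton_eq_iff)
  ultimately show ?thesis by (simp add: degree_def card_image)
qed

text \<open>Double counting of the incident pairs of a vertex and an edge.\<close>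

lemma sum_degree:
  assumes "finite_simple_graph X"
  shows "(\<Sum>v \<in> verts X. degree X v) = 2 * card (edges X)"
proof -
  have fin: "finite (verts X)" using assms by (simp add: finite_simple_graph_def)
  have "card {v \<in> verts X. v \<in> e} = 2" if "e \<in> edges X" for e
  proof -
    have "{v \<in> verts X. v \<in> e} = e" using that assms by (auto simp: finite_simple_graph_def)
    with that assms show ?thesis by (simp add: finite_simple_graph_def)
  qed
  with sum_multicount[of "verts X" "edges X" "(\<in>)" 2] fin finite_edges[OF assms]
  show ?thesis by (simp add: degree_def)
qed

section \<open>The corona\<close>

lemma verts_corona: "verts (corona G H) = Inl ` verts G \<union> Inr ` (verts G \<times> verts H)"
  by (simp add: corona_def)

lemma Setcompr2_eq_image: "{f x y | x y. x \<in> A \<and> y \<in> B} = (\<lambda>(x, y). f x y) ` (A \<times> B)"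
  by auto

text \<open>Images over products replace the set comprehensions, so that sums over the edges can
  later be reindexed.\<close>

lemma edges_corona:
  "edges (corona G H) = (`) Inl ` edges G
     \<union> (\<lambda>(g, e). (\<lambda>h. Inr (g, h)) ` e) ` (verts G \<times> edges H)
     \<union> (\<lambda>(g, h). {Inl g, Inr (g, h)}) ` (verts G \<times> verts H)"
  by (simp only: corona_def ugraph.sel Setcompr_eq_image
      Setcompr2_eq_image[of "\<lambda>g. (`) (\<lambda>h. Inr (g, h))"]
      Setcompr2_eq_image[of "\<lambda>g h. {Inl g, Inr (g, h)}"])

lemma finite_simple_graph_corona:
  assumes "finite_simple_graph G" and "finite_simple_graph H"
  shows "finite_simple_graph (corona G H)"
  unfolding finite_simple_graph_def
proof (intro conjI ballI)
  show "finite (verts (corona G H))"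
    using assms by (simp add: verts_corona finite_simple_graph_def)
  fix e assume "e \<in> edges (corona G H)"
  then consider (G) d where "d \<in> edges G" "e = Inl ` d"
    | (H) g d where "g \<in> verts G" "d \<in> edges H" "e = (\<lambda>h. Inr (g, h)) ` d"
    | (join) g h where "g \<in> verts G" "h \<in> verts H" "e = {Inl g, Inr (g, h)}"
    unfolding edges_corona by blast
  then have "e \<subseteq> verts (corona G H) \<and> card e = 2"
  proof cases
    case G
    then have "d \<subseteq> verts G" "card d = 2" using assms(1) by (auto simp: finite_simple_graph_def)
    with G show ?thesis by (auto simp: verts_corona card_image)
  next
    case H
    then have "d \<subseteq> verts H" "card d = 2" using assms(2) by (auto simp: finite_simple_graph_def)
    with H show ?thesis by (auto simp: verts_corona card_image inj_on_def)
  next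
    case join
    then show ?thesis by (simp add: verts_corona)
  qed
  then show "e \<subseteq> verts (corona G H)" and "card e = 2" by auto
qed

lemma doubleton_eq_image_iff:
  assumes "inj f"
  shows "{f x, f y} \<in> (`) f ` E \<longleftrightarrow> {x, y} \<in> E"
proof -
  have "{f x, f y} = f ` {x, y}" by simp
  then show ?thesis using inj_image_eq_iff[OF assms, of "{x, y}"] by (metis imageE imageI)
qed

lemma corona_edge_Inl_Inl: "{Inl a, Inl b} \<in> edges (corona G H) \<longleftrightarrow> {a, b} \<in> edges G"
  using doubleton_eq_image_iff[of "Inl :: 'a \<Rightarrow> 'a + 'a \<times> 'b" a b "edges G"]
  unfolding edges_corona by (auto simp: doubleton_eq_iff)

lemma corona_edge_Inr_Inr:
  "{Inr (a, h), Inr (b, k)} \<in> edges (corona G H) \<longleftrightarrow> a = b \<and> a \<in> verts G \<and> {h, k} \<in> edges H"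
proof
  assume "{Inr (a, h), Inr (b, k)} \<in> edges (corona G H)"
  then obtain g e where ge: "g \<in> verts G" "e \<in> edges H"
    "{Inr (a, h), Inr (b, k)} = (\<lambda>h. Inr (g, h) :: 'a + 'a \<times> 'b) ` e"
    unfolding edges_corona by (auto simp: doubleton_eq_iff)
  \<comment> \<open>Each of the two endpoints lies in the image and thus reveals that its first
    coordinate is \<open>g\<close>; injectivity then recovers \<open>e\<close>.\<close>
  then have "Inr (a, h) \<in> (\<lambda>h. Inr (g, h) :: 'a + 'a \<times> 'b) ` e"
    "Inr (b, k) \<in> (\<lambda>h. Inr (g, h) :: 'a + 'a \<times> 'b) ` e" by auto
  then have ab: "a = g" "b = g" by auto
  have "e = {h, k}"
    by (rule inj_image_eq_iff[THEN iffD1, of "\<lambda>h. Inr (g, h) :: 'a + 'a \<times> 'b"])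
      (use ge(3) ab in \<open>auto simp: inj_def\<close>)
  with ab ge show "a = b \<and> a \<in> verts G \<and> {h, k} \<in> edges H" by simp
next
  assume "a = b \<and> a \<in> verts G \<and> {h, k} \<in> edges H"
  then show "{Inr (a, h), Inr (b, k)} \<in> edges (corona G H)"
    unfolding edges_corona by (auto intro!: image_eqI[of _ _ "(a, {h, k})"])
qed

lemma corona_edge_Inl_Inr:
  "{Inl a, Inr (b, k)} \<in> edges (corona G H) \<longleftrightarrow> a = b \<and> a \<in> verts G \<and> k \<in> verts H"
proof -
  have "Inr (b, k) \<notin> e" if "e \<in> (`) Inl ` edges G" for e :: "('a + 'a \<times> 'b) set"
    using that by auto
  then have "{Inl a, Inr (b, k)} \<notin> (`) Inl ` edges G" by blast
  moreover have "Inl a \<notin> e"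
    if "e \<in> (\<lambda>(g, e). (\<lambda>h. Inr (g, h)) ` e) ` (verts G \<times> edges H)" for e :: "('a + 'a \<times> 'b) set"
    using that by auto
  then have "{Inl a, Inr (b, k)} \<notin> (\<lambda>(g, e). (\<lambda>h. Inr (g, h)) ` e) ` (verts G \<times> edges H)"
    by blast
  moreover have "{Inl a, Inr (b, k)} \<in> (\<lambda>(g, h). {Inl g, Inr (g, h)}) ` (verts G \<times> verts H)
      \<longleftrightarrow> a = b \<and> a \<in> verts G \<and> k \<in> verts H"
    by (simp add: image_iff Bex_def doubleton_eq_iff) metis
  ultimately show ?thesis unfolding edges_corona by blast
qed

lemma corona_edge_Inr_Inl:
  "{Inr (b, k), Inl a} \<in> edges (corona G H) \<longleftrightarrow> a = b \<and> a \<in> verts G \<and> k \<in> verts H"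
  unfolding insert_commute[of "Inr (b, k)" "Inl a"] by (rule corona_edge_Inl_Inr)

lemmas corona_edge_simps =
  corona_edge_Inl_Inl corona_edge_Inr_Inr corona_edge_Inl_Inr corona_edge_Inr_Inl

section \<open>Distance formulas in the corona\<close>

definition dist_to_Inl :: "'a ugraph \<Rightarrow> 'a \<Rightarrow> 'a + 'a \<times> 'b \<Rightarrow> enat" where
  "dist_to_Inl G a w =
     (case w of Inl g \<Rightarrow> graph_dist G g a | Inr (g, h) \<Rightarrow> graph_dist G g a + 1)"

text \<open>The distance to \<open>b\<close> inside one copy together with its attaching vertex. The
  detour through that vertex caps it at 2, so distances of \<open>H\<close> itself never
  enter.\<close>

definition copy_dist :: "'b ugraph \<Rightarrow> 'b \<Rightarrow> 'b \<Rightarrow> enat" where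
  "copy_dist H b h = (if h = b then 0 else if h \<in> nbrs H b then 1 else 2)"

text \<open>From a different copy the route leaves one copy and enters another, which costs 2 beyond
  the distance in \<open>G\<close>. The copy of \<open>b\<close> is separate because its vertices
  may be equal or adjacent to \<open>b\<close>.\<close>

definition dist_to_Inr :: "'a ugraph \<Rightarrow> 'b ugraph \<Rightarrow> 'a \<Rightarrow> 'b \<Rightarrow> 'a + 'a \<times> 'b \<Rightarrow> enat" where
  "dist_to_Inr G H a b w = (case w of Inl g \<Rightarrow> graph_dist G g a + 1
     | Inr (g, h) \<Rightarrow> if g = a then copy_dist H b h else graph_dist G g a + 2)"

lemma copy_dist_le_2: "copy_dist H b h \<le> 2"
  by (simp add: copy_dist_def one_enat_def numeral_eq_enat)

text \<open>Only \<open>k = b\<close> needs adjacency: otherwise the right-hand side is at least 2,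
  the largest value of \<open>copy_dist\<close>.\<close>

lemma copy_dist_edge:
  assumes "{h, k} \<in> edges H"
  shows "copy_dist H b h \<le> copy_dist H b k + 1"
proof (cases "k = b")
  case True
  then have "h \<in> nbrs H b" using assms by (simp add: nbrs_def insert_commute)
  then have "copy_dist H b h \<le> 1" by (simp add: copy_dist_def)
  then show ?thesis by (simp add: True copy_dist_def)
next
  case False
  then have "1 \<le> copy_dist H b k" by (simp add: copy_dist_def one_enat_def numeral_eq_enat)
  then have "1 + 1 \<le> copy_dist H b k + 1" by (rule add_right_mono)
  with copy_dist_le_2[of H b h] show ?thesis by (simp add: one_add_one)
qed

text \<open>An instance of \<open>graph_dist_eqI\<close>. The descent moves along a shortest path of
  \<open>G\<close>, or from a copy to its attaching vertex.\<close>

lemma graph_dist_corona_Inl: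
  assumes G: "finite_simple_graph G" and H: "finite_simple_graph H"
    and a: "a \<in> verts G" and w: "w \<in> verts (corona G H)"
  shows "graph_dist (corona G H) w (Inl a) = dist_to_Inl G a w"
proof (rule graph_dist_eqI[OF finite_simple_graph_corona[OF G H] _ _ _ _ _ w])
  show "Inl a \<in> verts (corona G H)" using a by (simp add: verts_corona)
  show "dist_to_Inl G a (Inl a) = 0" using a by (simp add: dist_to_Inl_def graph_dist_self)
  show "dist_to_Inl G a x \<le> dist_to_Inl G a y + 1" if "{x, y} \<in> edges (corona G H)" for x y
    using that graph_dist_edge[OF G]
    by (auto simp: dist_to_Inl_def corona_edge_simps add.assoc split: sum.splits)
  show "x = Inl a" if "dist_to_Inl G a x = 0" for x :: "'a + 'a \<times> 'b"
    using that graph_dist_eq_0 by (auto simp: dist_to_Inl_def split: sum.splits)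
  show "\<exists>y. {x, y} \<in> edges (corona G H) \<and> dist_to_Inl G a y = enat n"
    if x: "x \<in> verts (corona G H)" "dist_to_Inl G a x = enat (Suc n)" for x n
  proof (cases x)
    case (Inl g)
    then obtain y where "{g, y} \<in> edges G" "graph_dist G y a = enat n"
      using x graph_dist_Suc_neighbour[OF G, of g a n] by (auto simp: dist_to_Inl_def)
    with Inl show ?thesis
      by (intro exI[of _ "Inl y"]) (simp add: dist_to_Inl_def corona_edge_simps)
  next
    case (Inr p)
    then obtain g h where p: "p = (g, h)" "g \<in> verts G" "h \<in> verts H"
      using x by (auto simp: verts_corona)
    with Inr x show ?thesis
      by (cases "graph_dist G g a"; intro exI[of _ "Inl g"])
        (auto simp: dist_to_Inl_def corona_edge_simps one_enat_def)
  qed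
qed

lemma graph_dist_corona_Inr:
  assumes G: "finite_simple_graph G" and H: "finite_simple_graph H"
    and a: "a \<in> verts G" and b: "b \<in> verts H" and w: "w \<in> verts (corona G H)"
  shows "graph_dist (corona G H) w (Inr (a, b)) = dist_to_Inr G H a b w"
proof (rule graph_dist_eqI[OF finite_simple_graph_corona[OF G H] _ _ _ _ _ w])
  let ?f = "dist_to_Inr G H a b"
  have aa: "graph_dist G a a = 0" using a by (rule graph_dist_self)
  show "Inr (a, b) \<in> verts (corona G H)" using a b by (simp add: verts_corona)
  show "?f (Inr (a, b)) = 0" by (simp add: dist_to_Inr_def copy_dist_def)
  show "?f x \<le> ?f y + 1" if e: "{x, y} \<in> edges (corona G H)" for x y
  proof -
    consider (GG) c d where "x = Inl c" "y = Inl d" | (HH) c h k where "x = Inr (c, h)"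
        "y = Inr (c, k)" "{h, k} \<in> edges H"
      | (GH) c h where "x = Inl c" "y = Inr (c, h)" | (HG) c h where "x = Inr (c, h)" "y = Inl c"
      using e by (cases x; cases y) (auto simp: corona_edge_simps)
    then show ?thesis
    proof cases
      case GG
      with e graph_dist_edge[OF G, of c d a] show ?thesis
        by (auto simp: dist_to_Inr_def corona_edge_simps intro: add_right_mono)
    next
      case HH
      with copy_dist_edge[of h k H b] show ?thesis by (auto simp: dist_to_Inr_def)
    next
      case GH
      then show ?thesis using aa
        by (cases "graph_dist G c a")
          (auto simp: dist_to_Inr_def one_enat_def numeral_eq_enat zero_enat_def copy_dist_def)
    next
      case HG
      then show ?thesis using aa copy_dist_le_2[of H b h]
        by (cases "graph_dist G c a") (auto simp: dist_to_Inr_def one_enat_def numeral_eq_enat zero_enat_def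
            eval_nat_numeral)
    qed
  qed
  show "x = Inr (a, b)" if "?f x = 0" for x
    using that by (auto simp: dist_to_Inr_def copy_dist_def split: sum.splits if_splits)
  show "\<exists>y. {x, y} \<in> edges (corona G H) \<and> ?f y = enat n"
    if x: "x \<in> verts (corona G H)" "?f x = enat (Suc n)" for x n
  proof (cases x)
    case (Inl g)
    then have n: "graph_dist G g a = enat n"
      using x by (cases "graph_dist G g a") (auto simp: dist_to_Inr_def one_enat_def)
    \<comment> \<open>The candidate value at \<open>Inl g\<close> is \<open>n + 1\<close> with
      \<open>n\<close> the distance from \<open>g\<close> to \<open>a\<close>. For
      \<open>n = 0\<close> the next step is from \<open>a\<close> into the copy, straight to
      \<open>b\<close>; otherwise it stays in \<open>G\<close>.\<close>
    show ?thesis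
    proof (cases n)
      case 0
      then have "g = a" using n graph_dist_eq_0[of G g a] by (simp add: zero_enat_def)
      with 0 Inl a b show ?thesis
        by (intro exI[of _ "Inr (a, b)"])
          (simp add: dist_to_Inr_def copy_dist_def corona_edge_simps zero_enat_def)
    next
      case (Suc m)
      then obtain y where "{g, y} \<in> edges G" "graph_dist G y a = enat m"
        using n graph_dist_Suc_neighbour[OF G, of g a m] by auto
      with Inl Suc show ?thesis
        by (intro exI[of _ "Inl y"]) (simp add: dist_to_Inr_def corona_edge_simps one_enat_def)
    qed
  next
    case (Inr p)
    then obtain g h where p: "p = (g, h)" "g \<in> verts G" "h \<in> verts H"
      using x by (auto simp: verts_corona)
    show ?thesis
    \<comment> \<open>Neighbours of \<open>b\<close> in its copy descend directly to
      \<open>b\<close>; every other copy vertex of positive value descends to its attaching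
      vertex.\<close>
    proof (cases "g = a \<and> h \<in> nbrs H b")
      case True
      then have "h \<noteq> b" using edge_irrefl[OF H] by (auto simp: nbrs_def)
      with True x Inr p have "n = 0" by (simp add: dist_to_Inr_def copy_dist_def one_enat_def)
      with True p Inr show ?thesis
        by (intro exI[of _ "Inr (a, b)"])
          (auto simp: dist_to_Inr_def copy_dist_def corona_edge_simps zero_enat_def nbrs_def
            insert_commute)
    next
      case False
      then have "?f (Inl g) = enat n"
        using x Inr p aa
        by (cases "graph_dist G g a")
          (auto simp: dist_to_Inr_def copy_dist_def one_enat_def numeral_eq_enat zero_enat_def
            split: if_splits)
      with Inr p show ?thesis
        by (intro exI[of _ "Inl g"]) (simp add: corona_edge_simps)
    qed
  qed
qed

section \<open>Imbalance of the edges of the corona\<close>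

lemma card_Plus_image:
  assumes "finite A" and "finite B"
  shows "card (Inl ` A \<union> Inr ` B) = card A + card B"
  using card_Plus[OF assms] by (simp add: Plus_def)

text \<open>A copy vertex compares \<open>u\<close> and \<open>v\<close> exactly as its attaching
  vertex does, so each closer vertex of \<open>G\<close> brings its whole copy along.\<close>

lemma closer_count_corona_Inl_Inl:
  assumes G: "finite_simple_graph G" and H: "finite_simple_graph H"
    and u: "u \<in> verts G" and v: "v \<in> verts G"
  shows "closer_count (corona G H) (Inl u) (Inl v) = (card (verts H) + 1) * closer_count G u v"
proof -
  let ?S = "{w \<in> verts G. graph_dist G w u < graph_dist G w v}"
  have mono: "x + 1 < y + 1 \<longleftrightarrow> x < y" for x y :: enat
    by (cases x; cases y) (auto simp: one_enat_def)
  have "{w \<in> verts (corona G H).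
      graph_dist (corona G H) w (Inl u) < graph_dist (corona G H) w (Inl v)}
    = {w \<in> verts (corona G H). (dist_to_Inl G u w) < dist_to_Inl G v w}"
    using graph_dist_corona_Inl[OF G H u] graph_dist_corona_Inl[OF G H v] by auto
  also have "\<dots> = Inl ` ?S \<union> Inr ` (?S \<times> verts H)"
    by (auto simp: verts_corona dist_to_Inl_def mono)
  finally have "closer_count (corona G H) (Inl u) (Inl v) = card ?S + card (?S \<times> verts H)"
    using G H unfolding closer_count_def
    by (subst card_Plus_image[symmetric]) (auto simp: finite_simple_graph_def)
  then show ?thesis by (simp add: closer_count_def card_cartesian_product)
qed

text \<open>Outside the common copy both distances agree. Inside it, values 0, 1, 2 leave
  \<open>h\<close> itself and the vertices other than \<open>k\<close> that are adjacent to
  \<open>h\<close> but not to \<open>k\<close>.\<close>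

lemma closer_count_corona_Inr_Inr:
  assumes G: "finite_simple_graph G" and H: "finite_simple_graph H"
    and g: "g \<in> verts G" and e: "{h, k} \<in> edges H"
  shows "closer_count (corona G H) (Inr (g, h)) (Inr (g, k)) = card (nbrs H h - nbrs H k)"
proof -
  have hk: "h \<in> verts H" "k \<in> verts H" "h \<noteq> k" "k \<in> nbrs H h" "h \<in> nbrs H k"
    "h \<notin> nbrs H h" "k \<notin> nbrs H k"
    using edge_in_verts[OF H e] edge_irrefl[OF H] e by (auto simp: nbrs_def insert_commute)
  let ?S = "insert h (nbrs H h - nbrs H k - {k})"
  have "{w \<in> verts (corona G H).
      graph_dist (corona G H) w (Inr (g, h)) < graph_dist (corona G H) w (Inr (g, k))}
    = {w \<in> verts (corona G H). (dist_to_Inr G H g h w) < dist_to_Inr G H g k w}"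
    using graph_dist_corona_Inr[OF G H g hk(1)] graph_dist_corona_Inr[OF G H g hk(2)] by auto
  also have "\<dots> = (\<lambda>x. Inr (g, x)) ` {x \<in> verts H. copy_dist H h x < copy_dist H k x}"
    using g by (auto simp: verts_corona dist_to_Inr_def split: if_splits)
  also have "{x \<in> verts H. copy_dist H h x < copy_dist H k x} = ?S"
    using hk nbrs_subset[OF H, of h]
    by (auto simp: copy_dist_def zero_enat_def one_enat_def numeral_eq_enat split: if_splits)
  finally have "closer_count (corona G H) (Inr (g, h)) (Inr (g, k))
      = card ((\<lambda>x. Inr (g, x) :: 'a + 'a \<times> 'b) ` ?S)"
    by (simp add: closer_count_def)
  also have "\<dots> = card ?S" by (intro card_image) (auto simp: inj_on_def)
  \<comment> \<open>\<open>k\<close> belongs to \<open>nbrs H h - nbrs H k\<close>, so removing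
    \<open>k\<close> and adding \<open>h\<close> cancel in the count.\<close>
  also have "\<dots> = Suc (card (nbrs H h - nbrs H k - {k}))"
    using hk finite_nbrs[OF H, of h] by simp
  also have "\<dots> = card (nbrs H h - nbrs H k)"
    using hk finite_nbrs[OF H, of h] by (intro card_Suc_Diff1) auto
  finally show ?thesis .
qed

text \<open>Every other vertex of the copy has distance 1 to \<open>g\<close> and at least 1 to
  \<open>h\<close>; outside the copy, the distance to \<open>h\<close> is never the smaller
  one.\<close>

lemma closer_count_corona_Inr_Inl:
  assumes G: "finite_simple_graph G" and H: "finite_simple_graph H"
    and g: "g \<in> verts G" and h: "h \<in> verts H"
  shows "closer_count (corona G H) (Inr (g, h)) (Inl g) = 1"
proof -
  have less: "\<not> x + 1 < x" "\<not> x + 2 < x + 1" for x :: enat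
    by (cases x; auto simp: one_enat_def numeral_eq_enat)+
  have "{w \<in> verts (corona G H).
      graph_dist (corona G H) w (Inr (g, h)) < graph_dist (corona G H) w (Inl g)}
    = {w \<in> verts (corona G H). dist_to_Inr G H g h w < dist_to_Inl G g w}"
    using graph_dist_corona_Inr[OF G H g h] graph_dist_corona_Inl[OF G H g] by auto
  also have "\<dots> = {Inr (g, h)}"
    using g h less graph_dist_self[OF g]
    by (auto simp: verts_corona dist_to_Inr_def dist_to_Inl_def copy_dist_def one_enat_def
        numeral_eq_enat zero_enat_def split: if_splits)
  finally show ?thesis by (simp add: closer_count_def)
qed

text \<open>Stated additively to avoid truncated subtraction. In the copy of \<open>g\<close>,
  neighbours of \<open>h\<close> are equidistant from both ends and \<open>h\<close> prefers itself;
  these are the \<open>degree H h + 1\<close> vertices of \<open>?N\<close>.\<close>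

lemma closer_count_corona_Inl_Inr:
  assumes G: "finite_simple_graph G" and H: "finite_simple_graph H"
    and g: "g \<in> verts G" and h: "h \<in> verts H"
  shows "closer_count (corona G H) (Inl g) (Inr (g, h)) + degree H h + 1
    = card {x \<in> verts G. graph_dist G x g \<noteq> \<infinity>} * (card (verts H) + 1)"
proof -
  let ?C = "{x \<in> verts G. graph_dist G x g \<noteq> \<infinity>}"
  let ?N = "{g} \<times> insert h (nbrs H h)"
  have fin: "finite ?C" "finite (verts H)" using G H by (auto simp: finite_simple_graph_def)
  \<comment> \<open>Both comparisons fail at infinity, which restricts the count to the component of
    \<open>g\<close>.\<close>
  have less: "x < x + 1 \<longleftrightarrow> x \<noteq> \<infinity>" "x + 1 < x + 2 \<longleftrightarrow> x \<noteq> \<infinity>" for x :: enat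
    by (cases x; auto simp: one_enat_def numeral_eq_enat)+
  have "{w \<in> verts (corona G H).
      graph_dist (corona G H) w (Inl g) < graph_dist (corona G H) w (Inr (g, h))}
    = {w \<in> verts (corona G H). dist_to_Inl G g w < dist_to_Inr G H g h w}"
    using graph_dist_corona_Inr[OF G H g h] graph_dist_corona_Inl[OF G H g] by auto
  also have "\<dots> = Inl ` ?C \<union> Inr ` (?C \<times> verts H - ?N)"
    using g h graph_dist_self[OF g]
    by (auto simp: verts_corona dist_to_Inr_def dist_to_Inl_def copy_dist_def less
        one_enat_def numeral_eq_enat zero_enat_def split: if_splits)
  finally have "closer_count (corona G H) (Inl g) (Inr (g, h))
      = card ?C + card (?C \<times> verts H - ?N)"
    using fin unfolding closer_count_def by (simp add: card_Plus_image)
  moreover have sub: "?N \<subseteq> ?C \<times> verts H"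
    using g h graph_dist_self[OF g] nbrs_subset[OF H, of h] by (auto simp: zero_enat_def)
  then have "card (?C \<times> verts H - ?N) + card ?N = card (?C \<times> verts H)"
    using card_Diff_subset[OF finite_subset[OF sub] sub] card_mono[OF _ sub] fin by simp
  moreover have "card ?N = degree H h + 1"
    using edge_irrefl[OF H] finite_nbrs[OF H, of h]
    by (simp add: card_cartesian_product degree_eq_card_nbrs[OF H] nbrs_def)
  ultimately show ?thesis by (simp add: card_cartesian_product)
qed

section \<open>Imbalances of the three kinds of edges\<close>

definition imbalance :: "'a ugraph \<Rightarrow> 'a \<Rightarrow> 'a \<Rightarrow> int" where
  "imbalance X u v = \<bar>int (closer_count X u v) - int (closer_count X v u)\<bar>"

lemma imbalance_corona_Inl_Inl:
  assumes "finite_simple_graph G" and "finite_simple_graph H"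
    and "u \<in> verts G" and "v \<in> verts G"
  shows "imbalance (corona G H) (Inl u) (Inl v) = (int (card (verts H)) + 1) * imbalance G u v"
proof -
  have "imbalance (corona G H) (Inl u) (Inl v) = \<bar>(int (card (verts H)) + 1)
      * (int (closer_count G u v) - int (closer_count G v u))\<bar>"
    using assms by (simp add: imbalance_def closer_count_corona_Inl_Inl algebra_simps)
  then show ?thesis by (simp add: imbalance_def abs_mult)
qed

lemma imbalance_corona_Inr_Inr:
  assumes G: "finite_simple_graph G" and H: "finite_simple_graph H"
    and g: "g \<in> verts G" and e: "{h, k} \<in> edges H"
  shows "imbalance (corona G H) (Inr (g, h)) (Inr (g, k)) = \<bar>int (degree H h) - int (degree H k)\<bar>"
proof -
  have diff: "card (nbrs H x - nbrs H y) + card (nbrs H x \<inter> nbrs H y) = card (nbrs H x)" for x y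
    using card_Int_Diff[OF finite_nbrs[OF H], of x "nbrs H y"] by simp
  have e': "{k, h} \<in> edges H" using e by (simp add: insert_commute)
  show ?thesis
    using diff[of h k] diff[of k h]
    by (simp add: imbalance_def closer_count_corona_Inr_Inr[OF G H g e]
        closer_count_corona_Inr_Inr[OF G H g e'] degree_eq_card_nbrs[OF H] Int_commute)
qed

text \<open>With \<open>c\<close> the order of the component of \<open>g\<close>, the triangle
  inequality splits off the degree and leaves \<open>c * (s2 + 1) - 2\<close>, which is largest when
  \<open>c = s1\<close>.\<close>

lemma imbalance_corona_Inl_Inr:
  assumes G: "finite_simple_graph G" and H: "finite_simple_graph H"
    and g: "g \<in> verts G" and h: "h \<in> verts H"
  defines "s1 \<equiv> int (card (verts G))" and "s2 \<equiv> int (card (verts H))"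
  shows "imbalance (corona G H) (Inl g) (Inr (g, h)) \<le> \<bar>2 - s1 - s1 * s2\<bar> + int (degree H h)"
proof -
  define c where "c = card {x \<in> verts G. graph_dist G x g \<noteq> \<infinity>}"
  have fin: "finite (verts G)" "finite (verts H)" using G H by (auto simp: finite_simple_graph_def)
  have "c \<le> card (verts G)" unfolding c_def using fin by (intro card_mono) auto
  moreover have "c \<noteq> 0" unfolding c_def using fin g graph_dist_self[OF g] by (auto simp: zero_enat_def)
  moreover have "card (verts H) \<noteq> 0" using fin h by auto
  ultimately have *: "int c \<le> s1" "1 \<le> int c" "1 \<le> s2" unfolding s1_def s2_def by auto
  \<comment> \<open>Makes \<open>c * (s2 + 1) - 2\<close> nonnegative, so that enlarging
    \<open>c\<close> to \<open>s1\<close> cannot decrease its absolute value.\<close>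
  have "1 * 2 \<le> int c * (s2 + 1)" using * by (intro mult_mono) auto
  moreover have "int c * (s2 + 1) \<le> s1 * (s2 + 1)" using * by (intro mult_right_mono) auto
  moreover have "int (closer_count (corona G H) (Inl g) (Inr (g, h))) + int (degree H h) + 1
      = int c * (s2 + 1)"
    using arg_cong[OF closer_count_corona_Inl_Inr[OF G H g h], of int]
    by (simp add: c_def s2_def algebra_simps)
  ultimately show ?thesis
    by (simp add: imbalance_def closer_count_corona_Inr_Inl[OF G H g h] algebra_simps)
qed

section \<open>The Mostar index\<close>

text \<open>Names the summand of \<open>edge_sum\<close> as a function of the edge as a set, so that
  general lemmas on finite sums apply.\<close>

definition edge_val :: "('a \<Rightarrow> 'a \<Rightarrow> int) \<Rightarrow> 'a set \<Rightarrow> int" where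
  "edge_val f e = (THE r. \<exists>u v. e = {u, v} \<and> r = f u v)"

lemma edge_val_doubleton: "(\<And>x y. f x y = f y x) \<Longrightarrow> edge_val f {u, v} = f u v"
  unfolding edge_val_def by (rule edge_sum_summand)

lemma edge_sum_edge_val: "edge_sum X f = sum (edge_val f) (edges X)"
  by (simp add: edge_sum_def edge_val_def)

lemma edge_val_imbalance: "edge_val (imbalance X) {u, v} = imbalance X u v"
  by (rule edge_val_doubleton) (simp add: imbalance_def abs_minus_commute)

lemma Mostar_edge_val: "Mostar X = sum (edge_val (imbalance X)) (edges X)"
  by (simp add: Mostar_def edge_sum_edge_val imbalance_def[abs_def])

text \<open>The three families of edges are disjoint, being told apart by which of
  \<open>Inl\<close> and \<open>Inr\<close> occur in an edge, and each is parametrised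
  injectively.\<close>

lemma sum_edges_corona:
  assumes G: "finite_simple_graph G" and H: "finite_simple_graph H"
  shows "sum F (edges (corona G H)) = (\<Sum>e \<in> edges G. F (Inl ` e))
    + (\<Sum>g \<in> verts G. \<Sum>e \<in> edges H. F ((\<lambda>h. Inr (g, h)) ` e))
    + (\<Sum>g \<in> verts G. \<Sum>h \<in> verts H. F {Inl g, Inr (g, h)})"
proof -
  let ?b = "\<lambda>(g, e). (\<lambda>h. Inr (g, h) :: 'a + 'a \<times> 'b) ` e"
  let ?c = "\<lambda>(g, h). {Inl g, Inr (g, h) :: 'a + 'a \<times> 'b}"
  let ?A = "(`) Inl ` edges G :: ('a + 'a \<times> 'b) set set"
  let ?B = "?b ` (verts G \<times> edges H)"
  let ?C = "?c ` (verts G \<times> verts H)"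
  have fin: "finite (verts G)" "finite (verts H)" "finite (edges G)" "finite (edges H)"
    using G H finite_edges by (auto simp: finite_simple_graph_def)
  \<comment> \<open>An empty edge would have the same image in the first two families and in every
    copy of \<open>H\<close>.\<close>
  have ne: "{} \<notin> edges G" "{} \<notin> edges H" using G H by (auto simp: finite_simple_graph_def)
  have A: "Inr p \<notin> e" if "e \<in> ?A" for e p using that by auto
  have B: "Inl g \<notin> e" "e \<noteq> {}" if "e \<in> ?B" for e g using that ne by auto
  have AB: "?A \<inter> ?B = {}"
  proof (intro equals0I)
    fix e assume e: "e \<in> ?A \<inter> ?B"
    then have "Inl x \<notin> e" "Inr y \<notin> e" for x y using A B by blast+
    then have "e = {}" by (metis equals0I sum.exhaust)
    moreover have "e \<in> ?B" using e by (rule IntD2)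
    ultimately show False using B(2)[of e] by simp
  qed
  have C: "\<exists>g p. Inl g \<in> e \<and> Inr p \<in> e" if mem: "e \<in> ?C" for e
  proof -
    obtain q where e: "e = ?c q" using mem by (rule imageE)
    obtain g h where "q = (g, h)" by (cases q)
    with e have "e = {Inl g, Inr (g, h)}" by simp
    then have "Inl g \<in> e" "Inr (g, h) \<in> e" by simp_all
    then show ?thesis by blast
  qed
  have ABC: "(?A \<union> ?B) \<inter> ?C = {}"
  proof (intro equals0I)
    fix e assume e: "e \<in> (?A \<union> ?B) \<inter> ?C"
    then obtain g p where "Inl g \<in> e" "Inr p \<in> e" using C[of e] by (elim IntE) blast
    with e A[of e p] B(1)[of e g] show False by (elim IntE UnE) simp_all
  qed
  have injA: "inj_on ((`) Inl :: _ \<Rightarrow> ('a + 'a \<times> 'b) set) (edges G)"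
    by (auto simp: inj_on_def inj_image_eq_iff)
  have injB: "inj_on ?b (verts G \<times> edges H)"
  proof (rule inj_onI)
    fix p q assume p: "p \<in> verts G \<times> edges H" and q: "q \<in> verts G \<times> edges H" and eq: "?b p = ?b q"
    obtain g e g' e' where pq: "p = (g, e)" "q = (g', e')" by fastforce
    have img: "(\<lambda>h. Inr (g, h) :: 'a + 'a \<times> 'b) ` e = (\<lambda>h. Inr (g', h)) ` e'"
      using eq pq by simp
    \<comment> \<open>Any element of the edge reveals the index of its copy.\<close>
    obtain h where "h \<in> e" using p pq ne by fastforce
    then have "Inr (g, h) \<in> (\<lambda>h. Inr (g', h) :: 'a + 'a \<times> 'b) ` e'" using img by blast
    then have g: "g = g'" by auto
    have "inj (\<lambda>h. Inr (g', h) :: 'a + 'a \<times> 'b)" by (auto simp: inj_def)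
    with img g have "e = e'" by (simp add: inj_image_eq_iff)
    with g pq show "p = q" by simp
  qed
  have injC: "inj_on ?c (verts G \<times> verts H)" by (auto simp: inj_on_def doubleton_eq_iff)
  have "sum F (edges (corona G H)) = sum F ?A + sum F ?B + sum F ?C"
    unfolding edges_corona using fin AB ABC by (simp add: sum.union_disjoint)
  also have "sum F ?A = (\<Sum>e \<in> edges G. F (Inl ` e))"
    using injA by (simp add: sum.reindex)
  also have "sum F ?B = (\<Sum>g \<in> verts G. \<Sum>e \<in> edges H. F ((\<lambda>h. Inr (g, h)) ` e))"
    using injB by (simp add: sum.reindex sum.cartesian_product case_prod_beta')
  also have "sum F ?C = (\<Sum>g \<in> verts G. \<Sum>h \<in> verts H. F {Inl g, Inr (g, h)})"
    using injC by (simp add: sum.reindex sum.cartesian_product case_prod_beta')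
  finally show ?thesis .
qed

theorem theorem1:
  fixes G :: "'a ugraph" and H :: "'b ugraph" and s1 t1 s2 t2 :: nat
  assumes "finite_simple_graph G" and "finite_simple_graph H"
    and "card (verts G) = s1" and "card (edges G) = t1"
    and "card (verts H) = s2" and "card (edges H) = t2"
  shows "Mostar (corona G H) \<le>
    int s1 * irr H + (int s2 + 1) * Mostar G
      + int s1 * int s2 * \<bar>2 - int s1 - int s1 * int s2\<bar> + 2 * int s1 * int t2"
proof -
  note G = assms(1) and H = assms(2)
  let ?F = "edge_val (imbalance (corona G H))"
  let ?K = "\<bar>2 - int s1 - int s1 * int s2\<bar>"
  have "?F (Inl ` e) = (int s2 + 1) * edge_val (imbalance G) e" if "e \<in> edges G" for e
    using G that
    by (auto elim!: edge_cases
        simp: edge_val_imbalance imbalance_corona_Inl_Inl[OF G H] assms(5))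
  then have A: "(\<Sum>e \<in> edges G. ?F (Inl ` e)) = (int s2 + 1) * Mostar G"
    by (simp add: Mostar_edge_val sum_distrib_left)
  let ?D = "\<lambda>u v. \<bar>int (degree H u) - int (degree H v)\<bar>"
  have "?F ((\<lambda>h. Inr (g, h)) ` e) = edge_val ?D e" if "g \<in> verts G" "e \<in> edges H" for g e
  proof -
    obtain h k where e: "e = {h, k}" using edge_cases[OF H \<open>e \<in> edges H\<close>] by metis
    have "edge_val ?D {h, k} = ?D h k" by (rule edge_val_doubleton) (simp add: abs_minus_commute)
    with that e show ?thesis
      by (simp add: edge_val_imbalance imbalance_corona_Inr_Inr[OF G H])
  qed
  then have B: "(\<Sum>g \<in> verts G. \<Sum>e \<in> edges H. ?F ((\<lambda>h. Inr (g, h)) ` e)) = int s1 * irr H"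
    by (simp add: irr_def edge_sum_edge_val assms(3))
  \<comment> \<open>The sums over the other two kinds of edges are exact; only the joining edges are
    estimated.\<close>
  have "(\<Sum>h \<in> verts H. ?F {Inl g, Inr (g, h)}) \<le> int s2 * ?K + 2 * int t2" if "g \<in> verts G" for g
  proof -
    have "(\<Sum>h \<in> verts H. ?F {Inl g, Inr (g, h)}) \<le> (\<Sum>h \<in> verts H. ?K + int (degree H h))"
      using imbalance_corona_Inl_Inr[OF G H that] assms(3,5)
      by (intro sum_mono) (simp add: edge_val_imbalance)
    also have "\<dots> = int s2 * ?K + int (\<Sum>h \<in> verts H. degree H h)"
      by (simp add: sum.distrib assms(5))
    \<comment> \<open>Without \<open>of_nat_sum\<close> the cast stays outside the sum, where
      \<open>sum_degree\<close> can match.\<close>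
    finally show ?thesis by (simp add: sum_degree[OF H] assms(6) del: of_nat_sum)
  qed
  then have "(\<Sum>g \<in> verts G. \<Sum>h \<in> verts H. ?F {Inl g, Inr (g, h)})
      \<le> (\<Sum>g \<in> verts G. int s2 * ?K + 2 * int t2)"
    by (rule sum_mono)
  also have "\<dots> = int s1 * int s2 * ?K + 2 * int s1 * int t2"
    by (simp add: assms(3) algebra_simps)
  finally show ?thesis
    using A B by (simp add: Mostar_edge_val sum_edges_corona[OF G H])
qed

end
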